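(* Let $G\curvearrowright X$ be a Polish group action and suppose that $\psi\colon G\times X\to H$ is a cocycle with values in a Polish group $H$. Assume also that $\psi$ is continuous in the second variable. Then $\psi$ is (jointly) continuous in each of the following cases. (1) $\psi$ is Baire measurable. (2) $\psi_x$ is Baire measurable for a dense set of $x\in X$. (3) $G$ is locally compact and $\psi_x$ is Haar measurable for a dense set of $x\in X$. (4) $G$ is locally compact with Haar measure $\lambda$ and there is a fully supported $\sigma$-finite Borel measure $\mu$ on $X$ such that $\psi$ is $\lambda\times\mu$-measurable.
   Context: A Polish group action $G\curvearrowright X$ is an action of a Polish group $G$ on a Polish space $X$ such that the action map $G\times X\to X$ is jointly continuous. A cocycle for an action $G\curvearrowright X$ with values in a group $H$ is a map $\psi\colon G\times X\to H$ such that $\psi(gf,x)=\psi(g,fx)\cdot\psi(f,x)$ for all $g,f\in G$ and $x\in X$. For $g\in G$ and $x\in X$, the section maps $\psi_g\colon X\to H$ and $\psi_x\colon G\to H$ are defined by $\psi_g(z)=\psi(g,z)$ and $\psi_x(f)=\psi(f,x)$. The map $\psi$ is continuous in the second variable if $\psi_g\colon X\to H$ is continuous for every $g\in G$. A map between topological spaces is Baire measurable if the inverse image of every open set has the Baire property (i.e. differs from an open set by a meagre set). A map on $G$ is Haar measurable if inverse images of open sets are measurable with respect to (the completion of) a Haar measure on $G$. A map on $G\times X$ is $\lambda\times\mu$-measurable if inverse images of open sets are measurable with respect to (the completion of) the product measure $\lambda\times\mu$. A Borel measure $\mu$ on $X$ is fully supported if every non-empty open subset of $X$ has positive $\mu$-measure;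 $\mu$ is not assumed to be invariant or quasi-invariant under the action. *)

theory Defs
  imports "HOL-Analysis.Analysis"
begin

text \<open>
  A Polish space is a type of class \<^class>\<open>polish_space\<close>, and a Polish group is a type that is
  moreover of class \<^class>\<open>topological_group_add\<close>. The latter class uses additive notation but does
  not assume commutativity, so that \<open>g + f\<close>, \<open>0\<close> and \<open>- g\<close> stand for the product \<open>gf\<close>, the
  identity and the inverse. The complete metric of a Polish group is not assumed to be invariant.
\<close>

definition polish_group_action ::
    "('g::{polish_space, topological_group_add} \<Rightarrow> 'x::polish_space \<Rightarrow> 'x) \<Rightarrow> bool" where
  "polish_group_action act \<longleftrightarrow>
     (\<forall>x. act 0 x = x) \<and>
     (\<forall>g f x. act (g + f) x = act g (act f x)) \<and>
     continuous_on UNIV (\<lambda>(g, x). act g x)"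

definition cocycle ::
    "('g::group_add \<Rightarrow> 'x \<Rightarrow> 'x) \<Rightarrow> ('g \<times> 'x \<Rightarrow> 'h::group_add) \<Rightarrow> bool" where
  "cocycle act \<psi> \<longleftrightarrow> (\<forall>g f x. \<psi> (g + f, x) = \<psi> (g, act f x) + \<psi> (f, x))"

definition nowhere_dense :: "'a::topological_space set \<Rightarrow> bool" where
  "nowhere_dense S \<longleftrightarrow> interior (closure S) = {}"

definition meagre :: "'a::topological_space set \<Rightarrow> bool" where
  "meagre S \<longleftrightarrow> (\<exists>F. countable F \<and> (\<forall>T\<in>F. nowhere_dense T) \<and> S = \<Union>F)"

definition baire_property :: "'a::topological_space set \<Rightarrow> bool" where
  "baire_property S \<longleftrightarrow> (\<exists>U. open U \<and> meagre (sym_diff S U))"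

definition baire_measurable :: "('a::topological_space \<Rightarrow> 'b::topological_space) \<Rightarrow> bool" where
  "baire_measurable f \<longleftrightarrow> (\<forall>U. open U \<longrightarrow> baire_property (f -` U))"

text \<open>
  Haar measures are left invariant. Regularity is not listed, since a Borel measure that is finite
  on compact sets is automatically regular on a locally compact Polish space. Left and right Haar
  measures have the same null sets, so the choice of side does not affect measurability with
  respect to the completion.
\<close>

definition haar_measure :: "'g::{polish_space, topological_group_add} measure \<Rightarrow> bool" where
  "haar_measure M \<longleftrightarrow>
     sets M = sets borel \<and>
     emeasure M UNIV \<noteq> 0 \<and>
     (\<forall>K. compact K \<longrightarrow> emeasure M K < \<infinity>) \<and>
     (\<forall>g. \<forall>A \<in> sets borel. emeasure M ((+) g ` A) = emeasure M A)"

definition haar_measurable ::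
    "('g::{polish_space, topological_group_add} \<Rightarrow> 'b::topological_space) \<Rightarrow> bool" where
  "haar_measurable f \<longleftrightarrow> (\<exists>M. haar_measure M \<and> f \<in> borel_measurable (completion M))"

definition fully_supported :: "'a::topological_space measure \<Rightarrow> bool" where
  "fully_supported M \<longleftrightarrow> (\<forall>U. open U \<and> U \<noteq> {} \<longrightarrow> emeasure M U > 0)"

end

theory Submission
  imports Defs
begin

text \<open>
  By the cocycle identity, joint continuity of \<open>\<psi>\<close> everywhere follows from joint continuity at the
  points \<open>(0, x)\<close>: if \<open>h\<^sub>n \<longlonglongrightarrow> 0\<close> and \<open>y\<^sub>n \<longlonglongrightarrow> x\<close>, then \<open>\<psi> (h\<^sub>n, y\<^sub>n) \<longlonglongrightarrow> 0\<close>. The identity also gives, for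
  each \<open>k\<close>, the formula
  \<open>\<psi> (h\<^sub>n, y\<^sub>n) = - \<psi> (k, act h\<^sub>n y\<^sub>n) + \<psi> (k + h\<^sub>n, y\<^sub>n)\<close>. Its first summand tends to
  \<open>- \<psi> (k, x)\<close>, because \<open>\<psi>\<close> is continuous in the second variable. So it is enough to find one \<open>k\<close>
  for which \<open>\<psi> (k + h\<^sub>n, y\<^sub>n)\<close> tends to \<open>\<psi> (k, x)\<close> along a subsequence.

  Such a \<open>k\<close> comes from the countably many sets \<open>{g. \<forall>n\<ge>m. \<psi> (g, y\<^sub>n) \<in> B}\<close> with \<open>B\<close> in a countable
  base of the target group: they record the uniform behaviour in \<open>n\<close>, and each \<open>k\<close> with
  \<open>\<psi> (k, x) \<in> B\<close> belongs to one of them. It suffices that whenever \<open>k\<close> belongs to one of these sets,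
  so do eventually the points \<open>k + h\<^sub>n\<close> of the subsequence. The property
  \<open>translation_recurrent\<close> of a \<open>\<sigma>\<close>-algebra on the group asks for such a \<open>k\<close> and subsequence, given any
  countable family of measurable sets and any sequence \<open>h\<^sub>n \<longlonglongrightarrow> 0\<close>. It yields the
  continuity criterion \<open>cocycle_continuous_if_recurrent\<close>, where measurability of
  \<open>\<psi> (-, x)\<close> passes from a dense set of \<open>x\<close> to all \<open>x\<close> by taking pointwise limits.

  The \<open>\<sigma>\<close>-algebra of sets with the Baire property is translation recurrent: modulo a meagre set \<open>Z\<close>
  the given sets are open, and by the Baire category theorem some \<open>k\<close> has \<open>k\<close> and all \<open>k + h\<^sub>n\<close> outside
  \<open>Z\<close>. For the completion of a right Haar measure the argument of Lusin gives a compact set \<open>C\<close> of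
  positive measure on which the given sets are relatively open, and the sets \<open>{k. k + h\<^sub>n \<in> C}\<close>, which
  have the same measure as \<open>C\<close> and lie in small neighbourhoods of it, have an upper limit that meets
  \<open>C\<close>. By Fubini's theorem all left and all right Haar measures have the same null sets, so the
  Haar measure may change with \<open>x\<close>. Finally, the theorems of Kuratowski--Ulam and Fubini provide a
  dense set of measurable sections when measurability is assumed on the product.
\<close>

section \<open>Recurrence under small translations\<close>

text \<open>
  The point \<open>k\<close> and the subsequence have to serve all sets of the family at once. The
  subsequence is there for Haar measures: translates of a measurable set along \<open>h\<^sub>n \<longlonglongrightarrow> 0\<close> converge
  to it in measure, but in general not almost everywhere. A \<open>\<sigma>\<close>-algebra is represented by a measure,
  so that the library notion of a measurable map applies to it.
\<close>

definition translation_recurrent :: "'g::topological_group_add measure \<Rightarrow> bool" where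
  "translation_recurrent M \<longleftrightarrow>
     (\<forall>h A. h \<longlonglongrightarrow> 0 \<longrightarrow> (\<forall>i::nat. A i \<in> sets M) \<longrightarrow>
       (\<exists>k s. strict_mono s \<and>
         (\<forall>i. k \<in> A i \<longrightarrow> (\<forall>\<^sub>F n in sequentially. k + h (s n :: nat) \<in> A i))))"

lemma polish_group_action_tendsto:
  assumes act: "polish_group_action act" and lim: "u \<longlonglongrightarrow> g" "z \<longlonglongrightarrow> x"
  shows "(\<lambda>n. act (u n) (z n)) \<longlonglongrightarrow> act g x"
proof -
  have "continuous_on UNIV (\<lambda>p. act (fst p) (snd p))"
    using act by (simp add: polish_group_action_def case_prod_beta)
  from continuous_on_tendsto_compose[OF this tendsto_Pair[OF lim]] show ?thesis
    by simp
qed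

text \<open>
  Recurrence transports the convergence \<open>\<psi> (k, y\<^sub>n) \<longlonglongrightarrow> \<psi> (k, x)\<close> to the translates \<open>k + h\<^sub>n\<close>, and the
  cocycle identity then removes \<open>k\<close>.
\<close>

lemma cocycle_subsequence_tendsto_0:
  fixes act :: "'g::{polish_space, topological_group_add} \<Rightarrow> 'x::polish_space \<Rightarrow> 'x"
    and \<psi> :: "'g \<times> 'x \<Rightarrow> 'h::{polish_space, topological_group_add}"
  assumes act: "polish_group_action act"
    and coc: "cocycle act \<psi>"
    and cont: "\<And>g. continuous_on UNIV (\<lambda>x. \<psi> (g, x))"
    and M: "space M = UNIV" "translation_recurrent M"
    and meas: "\<And>x. (\<lambda>g. \<psi> (g, x)) \<in> borel_measurable M"
    and h: "h \<longlonglongrightarrow> 0" and y: "y \<longlonglongrightarrow> x"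
  shows "\<exists>s. strict_mono s \<and> (\<lambda>n. \<psi> (h (s n), y (s n))) \<longlonglongrightarrow> 0"
proof -
  obtain B :: "nat \<Rightarrow> 'h set" where B: "topological_basis (range B)"
  proof -
    obtain \<B> :: "'h set set" where \<B>: "countable \<B>" "topological_basis \<B>"
      using ex_countable_basis by blast
    have "\<B> \<noteq> {}"
      using \<B>(2) topological_basisE[OF \<B>(2), of UNIV] by force
    then have "range (from_nat_into \<B>) = \<B>"
      using \<B>(1) by (rule range_from_nat_into)
    then show ?thesis using \<B>(2) that by metis
  qed
  have Bopen: "open (B j)" for j
    using B by (rule topological_basis_open) simp
  define A where "A i = (case prod_decode i of (m, j) \<Rightarrow> {g. \<forall>n\<ge>m. \<psi> (g, y n) \<in> B j})" for i
  have "A i \<in> sets M" for i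
  proof (cases "prod_decode i")
    case (Pair m j)
    have "A i = (\<Inter>n\<in>{m..}. (\<lambda>g. \<psi> (g, y n)) -` B j)"
      by (auto simp: A_def Pair)
    moreover have "(\<lambda>g. \<psi> (g, y n)) -` B j \<in> sets M" for n
      using measurable_sets[OF meas borel_open[OF Bopen]] M(1) by simp
    ultimately show ?thesis
      by (auto intro!: sets.countable_INT'')
  qed
  then obtain k s where s: "strict_mono s"
    and ks: "\<And>i. k \<in> A i \<Longrightarrow> \<forall>\<^sub>F n in sequentially. k + h (s n) \<in> A i"
    using M(2) h unfolding translation_recurrent_def by metis
  have hs: "(\<lambda>n. h (s n)) \<longlonglongrightarrow> 0" and ys: "(\<lambda>n. y (s n)) \<longlonglongrightarrow> x"
    using LIMSEQ_subseq_LIMSEQ[OF h s] LIMSEQ_subseq_LIMSEQ[OF y s] by (simp_all add: o_def)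
  have \<psi>k: "(\<lambda>n. \<psi> (k, u n)) \<longlonglongrightarrow> \<psi> (k, z)" if "u \<longlonglongrightarrow> z" for u z
    using cont[of k] that by (auto simp: continuous_on_sequentially o_def)
  have lim: "(\<lambda>n. \<psi> (k + h (s n), y (s n))) \<longlonglongrightarrow> \<psi> (k, x)"
  proof (rule topological_tendstoI)
    fix U assume "open U" "\<psi> (k, x) \<in> U"
    then obtain j where j: "\<psi> (k, x) \<in> B j" "B j \<subseteq> U"
      using B topological_basisE by blast
    then have "\<forall>\<^sub>F n in sequentially. \<psi> (k, y n) \<in> B j"
      using topological_tendstoD[OF \<psi>k[OF y] Bopen] by blast
    then obtain m where "\<forall>n\<ge>m. \<psi> (k, y n) \<in> B j"
      by (auto simp: eventually_sequentially)
    then have "\<forall>\<^sub>F n in sequentially. k + h (s n) \<in> A (prod_encode (m, j))"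
      by (intro ks) (simp add: A_def)
    moreover have "\<forall>\<^sub>F n in sequentially. s n \<ge> m"
      using filterlim_subseq[OF s] by (auto simp: filterlim_at_top)
    ultimately show "\<forall>\<^sub>F n in sequentially. \<psi> (k + h (s n), y (s n)) \<in> U"
      by eventually_elim (use j(2) in \<open>auto simp: A_def\<close>)
  qed
  have "(\<lambda>n. act (h (s n)) (y (s n))) \<longlonglongrightarrow> act 0 x"
    by (rule polish_group_action_tendsto[OF act hs ys])
  then have "(\<lambda>n. \<psi> (k, act (h (s n)) (y (s n)))) \<longlonglongrightarrow> \<psi> (k, x)"
    using \<psi>k act by (auto simp: polish_group_action_def)
  then have "(\<lambda>n. - \<psi> (k, act (h (s n)) (y (s n))) + \<psi> (k + h (s n), y (s n)))
               \<longlonglongrightarrow> - \<psi> (k, x) + \<psi> (k, x)"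
    by (intro tendsto_add tendsto_minus lim)
  moreover have "- \<psi> (k, act g z) + \<psi> (k + g, z) = \<psi> (g, z)" for g z
    using coc by (simp add: cocycle_def add.assoc[symmetric])
  ultimately show ?thesis using s by auto
qed

text \<open>
  Convergence of \<open>(g\<^sub>n, x\<^sub>n)\<close> to \<open>(g, x)\<close> reduces to convergence at \<open>(0, act g x)\<close> by writing
  \<open>\<psi> (g\<^sub>n, x\<^sub>n) = \<psi> (g\<^sub>n - g, act g x\<^sub>n) + \<psi> (g, x\<^sub>n)\<close>.
\<close>

lemma cocycle_continuous_if_recurrent:
  fixes act :: "'g::{polish_space, topological_group_add} \<Rightarrow> 'x::polish_space \<Rightarrow> 'x"
    and \<psi> :: "'g \<times> 'x \<Rightarrow> 'h::{polish_space, topological_group_add}"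
  assumes act: "polish_group_action act"
    and coc: "cocycle act \<psi>"
    and cont: "\<And>g. continuous_on UNIV (\<lambda>x. \<psi> (g, x))"
    and M: "space M = UNIV" "translation_recurrent M"
    and D: "closure D = UNIV" "\<And>x. x \<in> D \<Longrightarrow> (\<lambda>g. \<psi> (g, x)) \<in> borel_measurable M"
  shows "continuous_on UNIV \<psi>"
proof -
  have meas: "(\<lambda>g. \<psi> (g, x)) \<in> borel_measurable M" for x
  proof -
    have "x \<in> closure D" using D(1) by simp
    then obtain u where u: "\<And>n. u n \<in> D" "u \<longlonglongrightarrow> x"
      by (auto simp: closure_sequential)
    show ?thesis
    proof (rule borel_measurable_LIMSEQ_metric)
      show "(\<lambda>g. \<psi> (g, u n)) \<in> borel_measurable M" for n
        by (intro D(2) u)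
      show "(\<lambda>n. \<psi> (g, u n)) \<longlonglongrightarrow> \<psi> (g, x)" for g
        using cont[of g] u(2) by (auto simp: continuous_on_sequentially o_def)
    qed
  qed
  have at_0: "(\<lambda>n. \<psi> (h n, y n)) \<longlonglongrightarrow> 0" if h: "h \<longlonglongrightarrow> 0" and y: "y \<longlonglongrightarrow> x" for h y x
  proof (rule ccontr)
    assume "\<not> ?thesis"
    then obtain V where V: "open V" "0 \<in> V" "\<not> (\<forall>\<^sub>F n in sequentially. \<psi> (h n, y n) \<in> V)"
      by (auto simp: tendsto_def)
    then obtain r :: "nat \<Rightarrow> nat" where r: "strict_mono r" "\<And>n. \<psi> (h (r n), y (r n)) \<notin> V"
      using not_eventually_sequentiallyD by blast
    have "(\<lambda>n. h (r n)) \<longlonglongrightarrow> 0" "(\<lambda>n. y (r n)) \<longlonglongrightarrow> x"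
      using LIMSEQ_subseq_LIMSEQ[OF h r(1)] LIMSEQ_subseq_LIMSEQ[OF y r(1)]
      by (simp_all add: o_def)
    from cocycle_subsequence_tendsto_0[OF act coc cont M meas this]
    obtain s where "(\<lambda>n. \<psi> (h (r (s n)), y (r (s n)))) \<longlonglongrightarrow> 0" by blast
    from topological_tendstoD[OF this V(1,2)] have "\<forall>\<^sub>F n in sequentially. False"
      using r(2) by simp
    then show False by simp
  qed
  show ?thesis
    unfolding continuous_on_sequentially
  proof (intro ballI allI impI, elim conjE)
    fix a :: "'g \<times> 'x" and p assume p: "p \<longlonglongrightarrow> a"
    obtain g x where a: "a = (g, x)" by (cases a)
    have g: "(\<lambda>n. fst (p n)) \<longlonglongrightarrow> g" and x: "(\<lambda>n. snd (p n)) \<longlonglongrightarrow> x"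
      using tendsto_fst[OF p] tendsto_snd[OF p] by (simp_all add: a)
    have "(\<lambda>n. fst (p n) - g) \<longlonglongrightarrow> g - g"
      using g by (intro tendsto_diff) auto
    then have h: "(\<lambda>n. fst (p n) - g) \<longlonglongrightarrow> 0"
      by simp
    have gx: "(\<lambda>n. act g (snd (p n))) \<longlonglongrightarrow> act g x"
      by (rule polish_group_action_tendsto[OF act tendsto_const x])
    have "(\<lambda>n. \<psi> (g, snd (p n))) \<longlonglongrightarrow> \<psi> (g, x)"
      using cont[of g] x by (auto simp: continuous_on_sequentially o_def)
    with at_0[OF h gx]
    have "(\<lambda>n. \<psi> (fst (p n) - g, act g (snd (p n))) + \<psi> (g, snd (p n))) \<longlonglongrightarrow> 0 + \<psi> (g, x)"
      by (rule tendsto_add)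
    moreover have "\<psi> (f - g, act g z) + \<psi> (g, z) = \<psi> (f, z)" for f z
      using coc unfolding cocycle_def by (metis diff_add_cancel)
    ultimately show "(\<psi> \<circ> p) \<longlonglongrightarrow> \<psi> a"
      by (simp add: a o_def)
  qed
qed

section \<open>Baire category\<close>

lemma nowhere_dense_iff: "nowhere_dense S \<longleftrightarrow> (\<exists>E. closed E \<and> S \<subseteq> E \<and> interior E = {})"
  unfolding nowhere_dense_def
  by (metis closed_closure closure_minimal closure_subset interior_mono subset_empty)

text \<open>
  Covers by closed sets with empty interior pass to subsets and to preimages under translations,
  which makes this form easier to use than an exact decomposition into nowhere dense sets.
\<close>

lemma meagre_iff:
  "meagre S \<longleftrightarrow> (\<exists>\<E>. countable \<E> \<and> (\<forall>E\<in>\<E>. closed E \<and> interior E = {}) \<and> S \<subseteq> \<Union>\<E>)"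
proof
  assume "meagre S"
  then obtain F where "countable F" "\<forall>T\<in>F. nowhere_dense T" "S = \<Union>F"
    by (auto simp: meagre_def)
  then show "\<exists>\<E>. countable \<E> \<and> (\<forall>E\<in>\<E>. closed E \<and> interior E = {}) \<and> S \<subseteq> \<Union>\<E>"
    using closure_subset
    by (intro exI[of _ "closure ` F"]) (fastforce simp: nowhere_dense_def)
next
  assume "\<exists>\<E>. countable \<E> \<and> (\<forall>E\<in>\<E>. closed E \<and> interior E = {}) \<and> S \<subseteq> \<Union>\<E>"
  then obtain \<E> where "countable \<E>" "\<forall>E\<in>\<E>. closed E \<and> interior E = {}" "S \<subseteq> \<Union>\<E>"
    by blast
  then show "meagre S"
    unfolding meagre_def nowhere_dense_iff
    by (intro exI[of _ "(\<lambda>E. S \<inter> E) ` \<E>"]) auto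
qed

lemma meagre_subset: "meagre T \<Longrightarrow> S \<subseteq> T \<Longrightarrow> meagre S"
  unfolding meagre_iff by (meson subset_trans)

lemma meagre_UN:
  assumes "countable I" "\<And>i. i \<in> I \<Longrightarrow> meagre (S i)"
  shows "meagre (\<Union>i\<in>I. S i)"
proof -
  have "\<exists>\<E>. countable \<E> \<and> (\<forall>E\<in>\<E>. closed E \<and> interior E = {}) \<and> S i \<subseteq> \<Union>\<E>" if "i \<in> I" for i
    using assms(2)[OF that] by (simp add: meagre_iff)
  then obtain \<E> where "\<And>i. i \<in> I \<Longrightarrow>
      countable (\<E> i) \<and> (\<forall>E\<in>\<E> i. closed E \<and> interior E = {}) \<and> S i \<subseteq> \<Union>(\<E> i)"
    by metis
  then show ?thesis
    unfolding meagre_iff using assms(1) by (intro exI[of _ "\<Union>i\<in>I. \<E> i"]) fastforce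
qed

lemma meagre_Un: "meagre S \<Longrightarrow> meagre T \<Longrightarrow> meagre (S \<union> T)"
  using meagre_UN[of "{S, T}" "\<lambda>S. S"] by auto

lemma interior_meagre:
  fixes S :: "'a::complete_space set"
  assumes "meagre S"
  shows "interior S = {}"
proof -
  obtain \<E> where \<E>: "countable \<E>" "\<And>E. E \<in> \<E> \<Longrightarrow> closed E \<and> interior E = {}" "S \<subseteq> \<Union>\<E>"
    using assms by (auto simp: meagre_iff)
  have "euclidean interior_of \<Union>\<E> = {}"
    using \<E> by (intro Baire_category_alt) (auto simp: completely_metrizable_space_euclidean)
  then show ?thesis
    using interior_mono[OF \<E>(3)] by simp
qed

lemma meagre_vimage_translation:
  fixes h :: "'g::{topological_group_add, t2_space}"
  assumes "meagre S"
  shows "meagre ((\<lambda>k. k + h) -` S)"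
proof -
  obtain \<E> where \<E>: "countable \<E>" "\<And>E. E \<in> \<E> \<Longrightarrow> closed E \<and> interior E = {}" "S \<subseteq> \<Union>\<E>"
    using assms by (auto simp: meagre_iff)
  have cont: "continuous_on UNIV (\<lambda>k. k + g)" for g :: 'g
    by (intro continuous_intros)
  have "closed ((\<lambda>k. k + h) -` E)" if "E \<in> \<E>" for E
    using \<E>(2)[OF that] cont by (simp add: closed_vimage)
  moreover have "interior ((\<lambda>k. k + h) -` E) = {}" if "E \<in> \<E>" for E
  proof (rule ccontr)
    assume "interior ((\<lambda>k. k + h) -` E) \<noteq> {}"
    then obtain k where k: "k \<in> interior ((\<lambda>k. k + h) -` E)" by blast
    have "open ((\<lambda>k. k + - h) -` interior ((\<lambda>k. k + h) -` E))"
      by (intro open_vimage cont) auto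
    moreover have "(\<lambda>k. k + - h) -` interior ((\<lambda>k. k + h) -` E) \<subseteq> E"
      using interior_subset by (fastforce simp: add.assoc)
    moreover have "k + h \<in> (\<lambda>k. k + - h) -` interior ((\<lambda>k. k + h) -` E)"
      using k by (simp add: add.assoc)
    ultimately have "k + h \<in> interior E"
      using interiorI by blast
    then show False using \<E>(2)[OF that] by simp
  qed
  moreover have "(\<lambda>k. k + h) -` S \<subseteq> \<Union>((\<lambda>E. (\<lambda>k. k + h) -` E) ` \<E>)"
    using \<E>(3) by (simp add: vimage_Union[symmetric] vimage_mono)
  ultimately show ?thesis
    unfolding meagre_iff using \<E>(1)
    by (intro exI[of _ "(\<lambda>E. (\<lambda>k. k + h) -` E) ` \<E>"]) simp
qed

lemma baire_propertyI: "open U \<Longrightarrow> meagre T \<Longrightarrow> sym_diff S U \<subseteq> T \<Longrightarrow> baire_property S"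
  unfolding baire_property_def using meagre_subset by blast

text \<open>
  Replacing the complement of an open set by its interior changes it only on the frontier, which is
  nowhere dense.
\<close>

lemma baire_property_Compl:
  assumes "baire_property S"
  shows "baire_property (- S)"
proof -
  obtain U where U: "open U" "meagre (sym_diff S U)"
    using assms by (auto simp: baire_property_def)
  have "interior (frontier U) \<inter> U = {}" "interior (frontier U) \<subseteq> closure U"
    using interior_subset[of "frontier U"] U(1) by (auto simp: frontier_def interior_open)
  then have "interior (frontier U) = {}"
    using open_Int_closure_eq_empty[OF open_interior, of "frontier U" U] by blast
  then have "meagre (frontier U)"
    unfolding meagre_iff by (intro exI[of _ "{frontier U}"]) simp
  then have "meagre (sym_diff S U \<union> frontier U)"
    using U(2) by (metis meagre_Un)
  moreover have "sym_diff (- S) (interior (- U)) \<subseteq> sym_diff S U \<union> frontier U"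
    using U(1) closure_subset[of U] closure_subset[of "- U"] by (auto simp: frontier_def interior_open interior_closure)
  ultimately show ?thesis
    using baire_propertyI[of "interior (- U)"] by blast
qed

lemma baire_property_UN:
  assumes "countable I" "\<And>i. i \<in> I \<Longrightarrow> baire_property (S i)"
  shows "baire_property (\<Union>i\<in>I. S i)"
proof -
  obtain U where U: "\<And>i. i \<in> I \<Longrightarrow> open (U i) \<and> meagre (sym_diff (S i) (U i))"
    using assms(2) unfolding baire_property_def by metis
  show ?thesis
  proof (rule baire_propertyI)
    show "open (\<Union>i\<in>I. U i)" using U by blast
    show "meagre (\<Union>i\<in>I. sym_diff (S i) (U i))"
      using assms(1) U by (intro meagre_UN) auto
  qed auto
qed

definition baire_algebra :: "'a::topological_space measure" where
  "baire_algebra = sigma UNIV {S. baire_property S}"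

lemma space_baire_algebra [simp]: "space baire_algebra = UNIV"
  by (simp add: baire_algebra_def space_measure_of_conv)

lemma sets_baire_algebra [simp]: "sets baire_algebra = {S. baire_property S}"
proof -
  have "baire_property ({} :: 'a set)"
    by (rule baire_propertyI[of "{}" "{}"]) (auto simp: meagre_iff)
  then have "sigma_algebra (UNIV :: 'a set) {S. baire_property S}"
    unfolding sigma_algebra_iff2
    by (auto simp: Compl_eq_Diff_UNIV[symmetric] baire_property_Compl intro!: baire_property_UN)
  then show ?thesis
    unfolding baire_algebra_def by (rule sigma_algebra.sets_measure_of_eq)
qed

lemma borel_measurable_baire_algebra_iff:
  "f \<in> borel_measurable baire_algebra \<longleftrightarrow> baire_measurable f"
proof
  assume "f \<in> borel_measurable baire_algebra"
  from measurable_sets[OF this borel_open] show "baire_measurable f"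
    by (simp add: baire_measurable_def)
next
  assume "baire_measurable f"
  then show "f \<in> borel_measurable baire_algebra"
    by (intro borel_measurableI) (simp add: baire_measurable_def)
qed

text \<open>
  Outside a meagre set the sets \<open>A i\<close> agree with open sets \<open>U i\<close>, and openness of \<open>U i\<close> gives the
  recurrence. In this case the whole sequence serves as the subsequence.
\<close>

lemma translation_recurrent_baire_algebra:
  "translation_recurrent (baire_algebra :: 'g::{polish_space, topological_group_add} measure)"
  unfolding translation_recurrent_def
proof (intro allI impI)
  fix h :: "nat \<Rightarrow> 'g" and A :: "nat \<Rightarrow> 'g set"
  assume h: "h \<longlonglongrightarrow> 0" and "\<forall>i. A i \<in> sets baire_algebra"
  then obtain U where U: "\<And>i. open (U i) \<and> meagre (sym_diff (A i) (U i))"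
    by (simp add: baire_property_def) metis
  define Z where "Z = (\<Union>i. sym_diff (A i) (U i))"
  have Z: "meagre Z"
    unfolding Z_def using U by (intro meagre_UN) auto
  then have "meagre (Z \<union> (\<Union>n. (\<lambda>k. k + h n) -` Z))"
    by (intro meagre_Un meagre_UN meagre_vimage_translation) auto
  then have "Z \<union> (\<Union>n. (\<lambda>k. k + h n) -` Z) \<noteq> UNIV"
    using interior_meagre by force
  then obtain k where k: "k \<notin> Z" "\<And>n. k + h n \<notin> Z"
    by blast
  have kh: "(\<lambda>n. k + h n) \<longlonglongrightarrow> k"
    using tendsto_add[OF tendsto_const h, of k] by simp
  have "\<forall>\<^sub>F n in sequentially. k + h n \<in> A i" if "k \<in> A i" for i
  proof -
    have "k \<in> U i" using that k(1) by (auto simp: Z_def)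
    then have "\<forall>\<^sub>F n in sequentially. k + h n \<in> U i"
      using topological_tendstoD[OF kh] U by blast
    then show ?thesis
      by eventually_elim (use k(2) in \<open>auto simp: Z_def\<close>)
  qed
  then show "\<exists>k s. strict_mono s \<and>
      (\<forall>i. k \<in> A i \<longrightarrow> (\<forall>\<^sub>F n in sequentially. k + h (s n :: nat) \<in> A i))"
    by (intro exI[of _ k] exI[of _ id]) (simp add: strict_mono_def)
qed

text \<open>
  This is the direct half of the theorem of Kuratowski and Ulam. Let \<open>E\<close> be closed with empty
  interior. If a section of \<open>E\<close> has interior points, then the section contains a nonempty basic open set \<open>V\<close>. For fixed \<open>V\<close> the set of all \<open>x\<close>
  with \<open>V \<times> {x} \<subseteq> E\<close> is closed, and an interior point of it would give a nonempty
  open rectangle inside \<open>E\<close>.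
\<close>

lemma meagre_exceptional_sections:
  fixes S :: "('a::second_countable_topology \<times> 'b::topological_space) set"
  assumes "meagre S"
  shows "meagre {x. \<not> meagre {g. (g, x) \<in> S}}"
proof -
  obtain \<E> where \<E>: "countable \<E>" "\<And>E. E \<in> \<E> \<Longrightarrow> closed E \<and> interior E = {}" "S \<subseteq> \<Union>\<E>"
    using assms by (auto simp: meagre_iff)
  obtain \<B> :: "'a set set" where \<B>: "countable \<B>" "topological_basis \<B>"
    using ex_countable_basis by blast
  define Q where "Q E V = {x. \<forall>g\<in>V. (g, x) \<in> E}" for E :: "('a \<times> 'b) set" and V
  have Qclosed: "closed (Q E V)" if "E \<in> \<E>" for E V
  proof -
    have "Q E V = (\<Inter>g\<in>V. Pair g -` E)"
      by (auto simp: Q_def)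
    then show ?thesis
      using \<E>(2)[OF that] by (auto intro!: closed_INT closed_vimage continuous_intros)
  qed
  have Qint: "interior (Q E V) = {}" if "E \<in> \<E>" "open V" "V \<noteq> {}" for E V
  proof (rule ccontr)
    assume ne: "interior (Q E V) \<noteq> {}"
    have "V \<times> interior (Q E V) \<subseteq> E"
      using interior_subset by (fastforce simp: Q_def)
    then have "V \<times> interior (Q E V) \<subseteq> interior E"
      using that(2) by (intro interior_maximal open_Times) auto
    then show False using ne that(3) \<E>(2)[OF that(1)] by auto
  qed
  have "{x. \<not> meagre {g. (g, x) \<in> S}} \<subseteq> (\<Union>(E, V)\<in>\<E> \<times> (\<B> - {{}}). Q E V)"
  proof (rule subsetI, rule ccontr)
    fix x assume x: "x \<in> {x. \<not> meagre {g. (g, x) \<in> S}}"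
      and nQ: "x \<notin> (\<Union>(E, V)\<in>\<E> \<times> (\<B> - {{}}). Q E V)"
    have "closed {g. (g, x) \<in> E} \<and> interior {g. (g, x) \<in> E} = {}" if "E \<in> \<E>" for E
    proof
      show "closed {g. (g, x) \<in> E}"
        using \<E>(2)[OF that] closed_vimage[of E "\<lambda>g. (g, x)"]
        by (simp add: vimage_def continuous_on_Pair)
      show "interior {g. (g, x) \<in> E} = {}"
      proof (rule ccontr)
        assume "interior {g. (g, x) \<in> E} \<noteq> {}"
        then obtain g where "g \<in> interior {g. (g, x) \<in> E}" by blast
        then obtain V where "V \<in> \<B>" "g \<in> V" "V \<subseteq> interior {g. (g, x) \<in> E}"
          using topological_basisE[OF \<B>(2) open_interior] by metis
        then have "x \<in> Q E V" "V \<in> \<B> - {{}}"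
          using interior_subset by (fastforce simp: Q_def)+
        then show False using nQ that by blast
      qed
    qed
    then have "meagre {g. (g, x) \<in> S}"
      unfolding meagre_iff using \<E>(1,3)
      by (intro exI[of _ "(\<lambda>E. {g. (g, x) \<in> E}) ` \<E>"]) auto
    then show False using x by simp
  qed
  moreover have "meagre (\<Union>(E, V)\<in>\<E> \<times> (\<B> - {{}}). Q E V)"
  proof (rule meagre_UN)
    show "countable (\<E> \<times> (\<B> - {{}}))"
      using \<E>(1) \<B>(1) by auto
    fix p assume "p \<in> \<E> \<times> (\<B> - {{}})"
    then obtain E V where p: "p = (E, V)" "E \<in> \<E>" "V \<in> \<B>" "V \<noteq> {}" by blast
    then have "closed (Q E V) \<and> interior (Q E V) = {}"
      using Qclosed Qint topological_basis_open[OF \<B>(2)] by blast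
    then show "meagre (case p of (E, V) \<Rightarrow> Q E V)"
      unfolding meagre_iff p by (intro exI[of _ "{Q E V}"]) auto
  qed
  ultimately show ?thesis
    by (rule meagre_subset[rotated])
qed

lemma borel_measurable_basisI:
  assumes "countable \<B>" "topological_basis \<B>"
    and "\<And>U. U \<in> \<B> \<Longrightarrow> f -` U \<inter> space M \<in> sets M"
  shows "f \<in> borel_measurable M"
  unfolding borel_eq_countable_basis[OF assms(1,2)]
  using assms(3) by (intro measurable_measure_of) auto

text \<open>
  A countable base of the target makes the exceptional set of \<open>x\<close> a countable union of meagre sets,
  and a meagre set in a Polish space has dense complement.
\<close>

lemma dense_baire_measurable_sections:
  fixes f :: "'a::polish_space \<times> 'b::polish_space \<Rightarrow> 'c::second_countable_topology"
  assumes "baire_measurable f"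
  shows "closure {x. baire_measurable (\<lambda>g. f (g, x))} = UNIV"
proof -
  obtain \<B> :: "'c set set" where \<B>: "countable \<B>" "topological_basis \<B>"
    using ex_countable_basis by blast
  have "baire_property (f -` U)" if "U \<in> \<B>" for U
    using assms topological_basis_open[OF \<B>(2) that] by (simp add: baire_measurable_def)
  then obtain W where W: "\<And>U. U \<in> \<B> \<Longrightarrow> open (W U) \<and> meagre (sym_diff (f -` U) (W U))"
    unfolding baire_property_def by metis
  define Z where "Z = (\<Union>U\<in>\<B>. {x. \<not> meagre {g. (g, x) \<in> sym_diff (f -` U) (W U)}})"
  have "meagre Z"
    unfolding Z_def using W \<B>(1) by (intro meagre_UN meagre_exceptional_sections) auto
  moreover have "- {x. baire_measurable (\<lambda>g. f (g, x))} \<subseteq> Z"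
  proof (rule subsetI, rule ccontr)
    fix x assume x: "x \<in> - {x. baire_measurable (\<lambda>g. f (g, x))}" and "x \<notin> Z"
    then have m: "meagre {g. (g, x) \<in> sym_diff (f -` U) (W U)}" if "U \<in> \<B>" for U
      using that by (auto simp: Z_def)
    have "(\<lambda>g. f (g, x)) \<in> borel_measurable baire_algebra"
    proof (rule borel_measurable_basisI[OF \<B>])
      fix U assume U: "U \<in> \<B>"
      have "baire_property ((\<lambda>g. f (g, x)) -` U)"
      proof (rule baire_propertyI)
        show "open ((\<lambda>g. (g, x)) -` W U)"
          using W[OF U] by (auto intro!: open_vimage continuous_intros)
      qed (use m[OF U] in auto)
      then show "(\<lambda>g. f (g, x)) -` U \<inter> space baire_algebra \<in> sets baire_algebra"
        by simp
    qed
    then show False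
      using x by (simp add: borel_measurable_baire_algebra_iff)
  qed
  ultimately have "interior (- {x. baire_measurable (\<lambda>g. f (g, x))}) = {}"
    using interior_meagre meagre_subset by blast
  then show ?thesis
    by (auto simp: interior_closure)
qed

section \<open>Recurrence for right invariant measures\<close>

text \<open>
  This allows changing the measure under a completion: to a restriction of it, or to another Haar
  measure.
\<close>

lemma sets_completion_mono:
  assumes "sets M = sets N" "null_sets M \<subseteq> null_sets N"
  shows "sets (completion M) \<subseteq> sets (completion N)"
proof
  fix A assume "A \<in> sets (completion M)"
  then obtain S Z Z' where "A = S \<union> Z" "Z \<subseteq> Z'" "Z' \<in> null_sets M" "S \<in> sets M"
    by (rule sets_completionE)
  then show "A \<in> sets (completion N)"
    using assms by (intro sets_completionI[of A S Z Z']) auto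
qed

lemma finite_measure_compact_subset:
  fixes B :: "'a::polish_space set"
  assumes "finite_measure M" "sets M = sets borel" "B \<in> sets borel" "0 < (e::real)"
  obtains K where "compact K" "K \<subseteq> B" "measure M (B - K) < e"
proof -
  interpret finite_measure M by fact
  have "(SUP K \<in> {K. K \<subseteq> B \<and> compact K}. emeasure M K) = emeasure M B"
    using inner_regular[OF assms(2) _ assms(3)] by (simp add: emeasure_finite)
  moreover have "{} \<in> {K. K \<subseteq> B \<and> compact K}" by simp
  ultimately obtain K where K: "K \<subseteq> B" "compact K" "emeasure M B < emeasure M K + ennreal e"
    using ennreal_approx_SUP
    by (metis (mono_tags, lifting) SUP_approx_ennreal assms(4) emeasure_finite empty_iff
        ennreal_less_zero_iff infinity_ennreal_def mem_Collect_eq)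
  have Ks: "K \<in> sets M" using K(2) assms(2) by (simp add: borel_compact)
  have "measure M B < measure M K + e"
    using K(3) assms(4) by (simp add: emeasure_eq_measure ennreal_plus[symmetric] ennreal_less_iff del: ennreal_plus)
  then have "measure M (B - K) < e"
    using K(1) Ks assms(2,3) by (subst finite_measure_Diff) auto
  then show ?thesis using K that by blast
qed

text \<open>
  For each \<open>i\<close>, inner regularity gives compact sets \<open>P i \<subseteq> A i\<close> and \<open>Q i \<subseteq> - A i\<close> that cover the space
  up to small measure. On the intersection of all \<open>P i \<union> Q i\<close> the set \<open>A i\<close> coincides with the open
  set \<open>- Q i\<close>.
\<close>

lemma lusin_compact:
  fixes A :: "nat \<Rightarrow> 'a::polish_space set"
  assumes fin: "finite_measure M" and sets: "sets M = sets borel"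
    and A: "\<And>i. A i \<in> sets (completion M)"
    and B: "B \<in> sets borel" "measure M B > 0"
  obtains C where "compact C" "C \<subseteq> B" "measure M C > 0"
    "\<And>i. openin (top_of_set C) (C \<inter> A i)"
proof -
  interpret finite_measure M by fact
  \<comment> \<open>The errors \<open>2 * e i\<close> add up to half the measure of \<open>B\<close>.\<close>
  define e where "e i = measure M B / 2 * (1/2) ^ Suc (Suc i)" for i :: nat
  have e: "e i > 0" for i using B(2) by (simp add: e_def)
  have "\<exists>P Q. compact P \<and> compact Q \<and> P \<subseteq> A i \<and> Q \<subseteq> - A i \<and> measure M (- (P \<union> Q)) < 2 * e i" for i
  proof -
    from A[of i] obtain S Z Z' where S: "A i = S \<union> Z" "Z \<subseteq> Z'" "Z' \<in> null_sets M" "S \<in> sets M"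
      by (rule sets_completionE)
    then have Sb: "S \<in> sets borel" "- (S \<union> Z') \<in> sets borel"
      using sets by auto
    obtain P where P: "compact P" "P \<subseteq> S" "measure M (S - P) < e i"
      using finite_measure_compact_subset[OF fin sets Sb(1) e] .
    obtain Q where Q: "compact Q" "Q \<subseteq> - (S \<union> Z')" "measure M (- (S \<union> Z') - Q) < e i"
      using finite_measure_compact_subset[OF fin sets Sb(2) e] .
    have PQ: "P \<in> sets M" "Q \<in> sets M" "- (S \<union> Z') \<in> sets M" "S \<in> sets M"
      using P(1) Q(1) Sb sets by (auto simp: borel_compact)
    have "measure M (- (P \<union> Q)) \<le> measure M ((S - P) \<union> (- (S \<union> Z') - Q) \<union> Z')"
      using S(3) PQ by (intro finite_measure_mono) auto
    also have "\<dots> \<le> measure M (S - P) + measure M (- (S \<union> Z') - Q) + measure M Z'"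
      using S(3) PQ by (intro order_trans[OF measure_Un_le] add_mono measure_Un_le) auto
    also have "measure M Z' = 0"
      using S(3) by (simp add: measure_eq_emeasure_eq_ennreal null_sets_def)
    finally have "measure M (- (P \<union> Q)) < 2 * e i"
      using P(3) Q(3) by simp
    then show ?thesis
      using P(1,2) Q(1,2) S(1,2) by (intro exI[of _ P] exI[of _ Q]) auto
  qed
  then obtain P Q where PQ: "\<And>i. compact (P i) \<and> compact (Q i) \<and> P i \<subseteq> A i \<and> Q i \<subseteq> - A i
      \<and> measure M (- (P i \<union> Q i)) < 2 * e i"
    by metis
  have PQs: "- (P i \<union> Q i) \<in> sets M" for i
    using PQ[of i] sets by (auto intro!: borel_closed simp: compact_imp_closed compact_Un simp del: Compl_Un)
  have "(\<lambda>i. measure M B / 2 * (1/2) ^ Suc i) sums (measure M B / 2 * 1)"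
    by (intro sums_mult power_half_series)
  moreover have "(\<lambda>i. measure M B / 2 * (1/2) ^ Suc i) = (\<lambda>i. 2 * e i)"
    by (simp add: e_def fun_eq_iff)
  ultimately have sums: "(\<lambda>i. 2 * e i) sums (measure M B / 2)"
    by simp
  have le: "measure M (- (P i \<union> Q i)) \<le> 2 * e i" for i
    using PQ[of i] by simp
  have summ: "summable (\<lambda>i. measure M (- (P i \<union> Q i)))"
    by (rule summable_comparison_test'[OF sums_summable[OF sums], of 0]) (use le in simp)
  have "measure M (\<Union>i. - (P i \<union> Q i)) \<le> (\<Sum>i. measure M (- (P i \<union> Q i)))"
    using PQs summ by (intro finite_measure_subadditive_countably) auto
  also have "\<dots> \<le> measure M B / 2"
    using suminf_le[OF le summ sums_summable[OF sums]] sums_unique[OF sums] by simp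
  finally have small: "measure M (\<Union>i. - (P i \<union> Q i)) \<le> measure M B / 2" .
  define C0 where "C0 = B - (\<Union>i. - (P i \<union> Q i))"
  have C0: "C0 \<in> sets borel"
    using B(1) PQs sets unfolding C0_def by auto
  have "measure M B \<le> measure M C0 + measure M (\<Union>i. - (P i \<union> Q i))"
    using C0 PQs sets B
    by (intro order_trans[OF finite_measure_mono measure_Un_le]) (auto simp: C0_def)
  then have pos: "measure M C0 > 0"
    using small B(2) by simp
  obtain C where C: "compact C" "C \<subseteq> C0" "measure M (C0 - C) < measure M C0"
    using finite_measure_compact_subset[OF fin sets C0 pos] .
  show ?thesis
  proof
    show "compact C" "C \<subseteq> B" using C by (auto simp: C0_def)
    have "C \<in> sets M" using C(1) sets by (simp add: borel_compact)
    then show "measure M C > 0"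
      using C C0 sets finite_measure_Diff[of C0 C] by simp
    fix i
    have "C \<inter> A i = C \<inter> - Q i"
      using PQ[of i] C(2) by (auto simp: C0_def)
    then show "openin (top_of_set C) (C \<inter> A i)"
      using PQ[of i] by (auto simp: compact_imp_closed open_Compl)
  qed
qed

text \<open>
  Let \<open>C\<close> be a compact set as in Lusin's theorem and \<open>V\<close> an open set around it of measure less than
  twice that of \<open>C\<close>. By right invariance the sets \<open>S n = {k. k + h n \<in> C}\<close> have the measure of \<open>C\<close>, and
  by compactness they eventually lie in \<open>V\<close>. So their upper limit also has at least the measure of
  \<open>C\<close>, and \<open>V\<close> has no room for it to be disjoint from \<open>C\<close>. A common point \<open>k\<close> returns to \<open>C\<close> infinitely
  often, and on \<open>C\<close> the given sets are relatively open.
\<close>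

lemma translation_recurrent_completion:
  fixes N :: "'g::{polish_space, topological_group_add} measure"
  assumes N: "sets N = sets borel"
    and inv: "\<And>g A. A \<in> sets borel \<Longrightarrow> emeasure N ((\<lambda>k. k + g) -` A) = emeasure N A"
    and Ob: "open Ob" "0 < emeasure N Ob" "emeasure N Ob < \<infinity>"
  shows "translation_recurrent (completion N)"
  unfolding translation_recurrent_def
proof (intro allI impI)
  fix h :: "nat \<Rightarrow> 'g" and A :: "nat \<Rightarrow> 'g set"
  assume h: "h \<longlonglongrightarrow> 0" and A: "\<forall>i. A i \<in> sets (completion N)"
  have Os: "Ob \<in> sets N" using Ob(1) N by simp
  have spN: "space N = UNIV" using sets_eq_imp_space_eq[OF N] by simp
  \<comment> \<open>Regularity is available for finite measures, so \<open>N\<close> is restricted to \<open>Ob\<close>.\<close>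
  define M where "M = density N (indicator Ob)"
  have sets: "sets M = sets borel" by (simp add: M_def N)
  have space: "space M = UNIV" by (simp add: M_def spN)
  have eM: "emeasure M S = emeasure N (Ob \<inter> S)" if "S \<in> sets borel" for S
    unfolding M_def using Os that N
    by (simp add: emeasure_density indicator_inter_arith[symmetric])
  interpret finite_measure M
    by standard (use eM[of UNIV] Ob(3) in \<open>simp add: space\<close>)
  have "null_sets N \<subseteq> null_sets M"
  proof
    fix S assume S: "S \<in> null_sets N"
    then have "emeasure N (Ob \<inter> S) = 0"
      using null_set_Int1[OF S Os] by (auto simp: null_sets_def Int_commute)
    then show "S \<in> null_sets M"
      using S N sets eM[of S] by (auto simp: null_sets_def)
  qed
  then have "A i \<in> sets (completion M)" for i
    using A sets_completion_mono[of N M] N sets by auto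
  moreover have "measure M Ob \<noteq> 0"
    using eM[of Ob] Ob by (auto simp: emeasure_eq_measure)
  then have "measure M Ob > 0"
    by (simp add: less_le)
  ultimately obtain C where C: "compact C" "C \<subseteq> Ob" "measure M C > 0"
    and rel: "\<And>i. openin (top_of_set C) (C \<inter> A i)"
    using lusin_compact[OF finite_measure_axioms sets _ borel_open[OF Ob(1)]] by metis
  have Cs: "C \<in> sets borel" using C(1) by (simp add: borel_compact)
  define S where "S n = (\<lambda>k. k + h n) -` C" for n
  have cont: "continuous_on UNIV (\<lambda>k. k + g)" for g :: 'g
    by (intro continuous_intros)
  have Ss: "S n \<in> sets borel" for n
    unfolding S_def using C(1) cont
    by (intro borel_closed closed_vimage compact_imp_closed)
  obtain V where V: "open V" "C \<subseteq> V" "V \<subseteq> Ob" "measure M V < 2 * measure M C"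
  proof -
    have "emeasure M C = (INF U \<in> {U. C \<subseteq> U \<and> open U}. emeasure M U)"
      using outer_regular[OF sets _ Cs] by simp
    moreover have "emeasure M C < ennreal (2 * measure M C)"
      using C(3) by (simp add: emeasure_eq_measure ennreal_less_iff)
    ultimately obtain U where U: "C \<subseteq> U" "open U" "emeasure M U < ennreal (2 * measure M C)"
      by (auto simp: INF_less_iff)
    have "measure M U < 2 * measure M C"
      using U(3) by (simp add: emeasure_eq_measure ennreal_less_iff)
    moreover have "measure M (U \<inter> Ob) \<le> measure M U"
      using U(2) sets by (intro finite_measure_mono) auto
    ultimately show ?thesis
      using that[of "U \<inter> Ob"] U(1,2) C(2) Ob(1) by auto
  qed
  have "\<forall>\<^sub>F n in sequentially. S n \<subseteq> V"
  proof (rule ccontr)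
    assume "\<not> ?thesis"
    then obtain r :: "nat \<Rightarrow> nat" where r: "strict_mono r" "\<And>n. \<not> S (r n) \<subseteq> V"
      using not_eventually_sequentiallyD by blast
    then obtain k where k: "\<And>n. k n + h (r n) \<in> C \<and> k n \<notin> V"
      unfolding S_def subset_iff vimage_def mem_Collect_eq by metis
    have "seq_compact C"
      using C(1) by (simp add: compact_eq_seq_compact_metric)
    then obtain c q where q: "c \<in> C" "strict_mono q" "(\<lambda>n. k (q n) + h (r (q n))) \<longlonglongrightarrow> c"
      using k seq_compactE[of C "\<lambda>n. k n + h (r n)"] by (auto simp: o_def)
    have "(\<lambda>n. h (r (q n))) \<longlonglongrightarrow> 0"
      using LIMSEQ_subseq_LIMSEQ[OF h strict_mono_o[OF r(1) q(2)]] by (simp add: o_def)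
    then have "(\<lambda>n. (k (q n) + h (r (q n))) - h (r (q n))) \<longlonglongrightarrow> c - 0"
      using q(3) by (intro tendsto_diff)
    then have "(\<lambda>n. k (q n)) \<longlonglongrightarrow> c"
      by (simp add: add_diff_eq)
    then have "\<forall>\<^sub>F n in sequentially. k (q n) \<in> V"
      using V(1,2) q(1) topological_tendstoD by blast
    then have "\<forall>\<^sub>F n::nat in sequentially. False"
      using k by simp
    then show False by simp
  qed
  then obtain m where m: "\<And>n. n \<ge> m \<Longrightarrow> S n \<subseteq> V"
    by (auto simp: eventually_sequentially)
  have mS: "measure M (S n) = measure M C" if "n \<ge> m" for n
  proof -
    have "Ob \<inter> S n = S n" "Ob \<inter> C = C"
      using m[OF that] V(3) C(2) by auto
    then show ?thesis
      using inv[OF Cs, of "h n"] eM[OF Ss, of n] eM[OF Cs]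
      by (simp add: S_def measure_def)
  qed
  \<comment> \<open>The intersection of the sets \<open>T j\<close> is the upper limit of the sets \<open>S n\<close>.\<close>
  define T where "T j = (\<Union>n\<in>{m + j..}. S n)" for j
  have Ts: "T j \<in> sets M" for j
    unfolding T_def using Ss sets by auto
  have TV: "T j \<subseteq> V" for j
    unfolding T_def by (rule UN_least) (simp add: m)
  have "measure M C \<le> measure M (T j)" for j
    using mS[of "m + j"] finite_measure_mono[of "S (m + j)" "T j"] Ts by (auto simp: T_def)
  moreover have "(\<lambda>j. measure M (T j)) \<longlonglongrightarrow> measure M (\<Inter>j. T j)"
    using Ts by (intro finite_Lim_measure_decseq) (fastforce simp: decseq_def T_def)+
  ultimately have L: "measure M C \<le> measure M (\<Inter>j. T j)"
    by (intro LIMSEQ_le_const) auto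
  have "C \<inter> (\<Inter>j. T j) \<noteq> {}"
  proof
    assume disj: "C \<inter> (\<Inter>j. T j) = {}"
    have "measure M C + measure M (\<Inter>j. T j) = measure M (C \<union> (\<Inter>j. T j))"
      using Cs Ts sets disj by (intro finite_measure_Union[symmetric]) auto
    moreover have "C \<union> (\<Inter>j. T j) \<subseteq> V"
      using V(2) TV[of 0] by blast
    then have "measure M (C \<union> (\<Inter>j. T j)) \<le> measure M V"
      using V(1) sets by (intro finite_measure_mono) auto
    ultimately show False using L V(4) by simp
  qed
  then obtain k where k: "k \<in> C" "\<And>j. k \<in> T j" by blast
  have "\<not> (\<forall>\<^sub>F n in sequentially. k + h n \<notin> C)"
  proof
    assume "\<forall>\<^sub>F n in sequentially. k + h n \<notin> C"
    then obtain j where "\<And>n. n \<ge> j \<Longrightarrow> k + h n \<notin> C"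
      by (auto simp: eventually_sequentially)
    moreover obtain n where "n \<ge> m + j" "k + h n \<in> C"
      using k(2)[of j] by (auto simp: T_def S_def)
    ultimately show False by simp
  qed
  then obtain s :: "nat \<Rightarrow> nat" where s: "strict_mono s" "\<And>n. k + h (s n) \<in> C"
    using not_eventually_sequentiallyD by blast
  have "(\<lambda>n. k + h (s n)) \<longlonglongrightarrow> k + 0"
    using LIMSEQ_subseq_LIMSEQ[OF h s(1)] by (intro tendsto_add) (auto simp: o_def)
  then have ks: "(\<lambda>n. k + h (s n)) \<longlonglongrightarrow> k" by simp
  have "\<forall>\<^sub>F n in sequentially. k + h (s n) \<in> A i" if "k \<in> A i" for i
  proof -
    obtain U where U: "open U" "C \<inter> A i = C \<inter> U"
      using rel[of i] by (auto simp: openin_open)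
    then have "\<forall>\<^sub>F n in sequentially. k + h (s n) \<in> U"
      using topological_tendstoD[OF ks U(1)] k(1) that by blast
    then show ?thesis
      by eventually_elim (use s(2) U(2) in blast)
  qed
  then show "\<exists>k s. strict_mono s \<and>
      (\<forall>i. k \<in> A i \<longrightarrow> (\<forall>\<^sub>F n in sequentially. k + h (s n :: nat) \<in> A i))"
    using s(1) by blast
qed

section \<open>Left and right Haar measures\<close>

lemma haar_measure_space:
  assumes "haar_measure M"
  shows "sets M = sets borel" "space M = UNIV"
  using assms sets_eq_imp_space_eq[of M borel] by (auto simp: haar_measure_def)

text \<open>
  Relatively compact open sets cover the group and have finite measure, and a second countable space
  is Lindelof. Both \<open>\<sigma>\<close>-finiteness and the existence of an open set of finite positive measure
  follow from such a cover.
\<close>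

lemma haar_measure_countable_cover:
  fixes M :: "'g::{polish_space, topological_group_add} measure"
  assumes M: "haar_measure M" and lc: "locally compact (UNIV :: 'g set)"
  obtains \<U> where "countable \<U>" "\<And>U. U \<in> \<U> \<Longrightarrow> open U \<and> emeasure M U < \<infinity>" "\<Union>\<U> = UNIV"
proof -
  let ?F = "{U. open U \<and> emeasure M U < \<infinity>}"
  have "x \<in> \<Union>?F" for x
  proof -
    obtain U K where UK: "open U" "compact K" "x \<in> U" "U \<subseteq> K"
      using lc[unfolded locally_def, rule_format, of UNIV x] by (auto simp: subtopology_UNIV)
    then have "emeasure M U \<le> emeasure M K"
      using haar_measure_space[OF M] by (intro emeasure_mono) (auto simp: borel_compact)
    also have "\<dots> < \<infinity>"
      using M UK(2) by (auto simp: haar_measure_def)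
    finally show ?thesis using UK by blast
  qed
  moreover obtain \<U> where "\<U> \<subseteq> ?F" "countable \<U>" "\<Union>\<U> = \<Union>?F"
    using Lindelof[of ?F] by blast
  ultimately show ?thesis
    using that[of \<U>] by blast
qed

lemma haar_measure_sigma_finite:
  fixes M :: "'g::{polish_space, topological_group_add} measure"
  assumes "haar_measure M" "locally compact (UNIV :: 'g set)"
  shows "sigma_finite_measure M"
proof -
  obtain \<U> where \<U>: "countable \<U>" "\<And>U. U \<in> \<U> \<Longrightarrow> open U \<and> emeasure M U < \<infinity>" "\<Union>\<U> = UNIV"
    using haar_measure_countable_cover[OF assms] by blast
  show ?thesis
  proof
    have "U \<in> sets M" "emeasure M U \<noteq> \<infinity>" if "U \<in> \<U>" for U
      using \<U>(2)[OF that] haar_measure_space(1)[OF assms(1)] by auto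
    then show "\<exists>A. countable A \<and> A \<subseteq> sets M \<and> \<Union>A = space M \<and> (\<forall>a\<in>A. emeasure M a \<noteq> \<infinity>)"
      using \<U>(1,3) haar_measure_space(2)[OF assms(1)] by (intro exI[of _ \<U>]) (simp add: subset_iff)
  qed
qed

lemma haar_measure_open:
  fixes M :: "'g::{polish_space, topological_group_add} measure"
  assumes "haar_measure M" "locally compact (UNIV :: 'g set)"
  obtains U where "open U" "0 < emeasure M U" "emeasure M U < \<infinity>"
proof -
  obtain \<U> where \<U>: "countable \<U>" "\<And>U. U \<in> \<U> \<Longrightarrow> open U \<and> emeasure M U < \<infinity>" "\<Union>\<U> = UNIV"
    using haar_measure_countable_cover[OF assms] by blast
  have "\<exists>U\<in>\<U>. emeasure M U \<noteq> 0"
  proof (rule ccontr)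
    assume "\<not> ?thesis"
    then have "(\<Union>U\<in>\<U>. U) \<in> null_sets M"
      using \<U>(1,2) haar_measure_space[OF assms(1)] by (intro null_sets_UN') auto
    then show False
      using \<U>(3) assms(1) by (auto simp: haar_measure_def)
  qed
  then show ?thesis
    using \<U>(2) that by (metis gr_zeroI)
qed

text \<open>
  The image of a left Haar measure under inversion is a right Haar measure, for which the translations
  \<open>k \<mapsto> k + h\<^sub>n\<close> in the cocycle identity preserve the measure.
\<close>

definition reflected :: "'g::topological_group_add measure \<Rightarrow> 'g measure" where
  "reflected M = distr M borel uminus"

lemma
  fixes M :: "'g::{polish_space, topological_group_add} measure"
  assumes "haar_measure M"
  shows sets_reflected: "sets (reflected M) = sets borel"
    and space_reflected: "space (reflected M) = UNIV"
    and emeasure_reflected: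
      "A \<in> sets borel \<Longrightarrow> emeasure (reflected M) A = emeasure M (uminus -` A)"
    and emeasure_reflected_translation:
      "A \<in> sets borel \<Longrightarrow> emeasure (reflected M) ((\<lambda>k. k + g) -` A) = emeasure (reflected M) A"
proof -
  show "sets (reflected M) = sets borel" "space (reflected M) = UNIV"
    by (simp_all add: reflected_def)
  have um: "uminus \<in> borel_measurable (borel :: 'g measure)"
    by (intro borel_measurable_continuous_onI continuous_intros)
  then have "uminus \<in> M \<rightarrow>\<^sub>M borel"
    using haar_measure_space[OF assms] by (simp cong: measurable_cong_sets)
  then have e: "emeasure (reflected M) A = emeasure M (uminus -` A)" if "A \<in> sets borel" for A
    using that haar_measure_space[OF assms] by (simp add: reflected_def emeasure_distr)
  then show "A \<in> sets borel \<Longrightarrow> emeasure (reflected M) A = emeasure M (uminus -` A)" .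
  assume A: "A \<in> sets borel"
  have tr: "(\<lambda>k. k + g) \<in> borel_measurable borel"
    by (intro borel_measurable_continuous_onI continuous_intros)
  have A': "uminus -` A \<in> sets borel"
    using measurable_sets[OF um A] by simp
  have "uminus -` ((\<lambda>k. k + g) -` A) = (+) g ` (uminus -` A)"
  proof (intro set_eqI iffI)
    fix k assume "k \<in> uminus -` ((\<lambda>k. k + g) -` A)"
    then have "- g + k \<in> uminus -` A" "k = g + (- g + k)"
      by (simp_all add: minus_add add.assoc[symmetric])
    then show "k \<in> (+) g ` (uminus -` A)" by blast
  qed (auto simp: minus_add add.assoc)
  then show "emeasure (reflected M) ((\<lambda>k. k + g) -` A) = emeasure (reflected M) A"
    using e[OF A] e[of "(\<lambda>k. k + g) -` A"] measurable_sets[OF tr A] A' assms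
    by (simp add: haar_measure_def)
qed

text \<open>
  Compute the \<open>N \<Otimes>\<^sub>M M\<close>-measure of \<open>{(x, y). x + y \<in> A}\<close> in both orders. The sections are left
  translates of \<open>A\<close>, of constant \<open>M\<close>-measure, and right translates of \<open>A\<close>, of constant \<open>N\<close>-measure.
  Hence \<open>M A * N UNIV = N A * M UNIV\<close> in the extended nonnegative reals, and since the total masses are
  nonzero, \<open>M A\<close> and \<open>N A\<close> vanish together.
\<close>

lemma left_right_invariant_null_sets:
  fixes M N :: "'g::{polish_space, topological_group_add} measure"
  assumes fin: "sigma_finite_measure M" "sigma_finite_measure N"
    and sets: "sets M = sets borel" "sets N = sets borel"
    and ne: "emeasure M UNIV \<noteq> 0" "emeasure N UNIV \<noteq> 0"
    and left: "\<And>g A. A \<in> sets borel \<Longrightarrow> emeasure M ((+) g -` A) = emeasure M A"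
    and right: "\<And>g A. A \<in> sets borel \<Longrightarrow> emeasure N ((\<lambda>k. k + g) -` A) = emeasure N A"
  shows "null_sets M = null_sets N"
proof -
  interpret NM: pair_sigma_finite N M
    using fin by (simp add: pair_sigma_finite_def)
  have sp: "space M = UNIV" "space N = UNIV"
    using sets[THEN sets_eq_imp_space_eq] by simp_all
  have key: "emeasure M A * emeasure N UNIV = emeasure N A * emeasure M UNIV"
    if A: "A \<in> sets borel" for A
  proof -
    define X where "X = (\<lambda>p. fst p + snd p) -` A"
    have "(\<lambda>p. fst p + snd p) \<in> borel_measurable (borel :: ('g \<times> 'g) measure)"
      by (intro borel_measurable_continuous_onI continuous_intros)
    then have "X \<in> sets (borel :: ('g \<times> 'g) measure)"
      using measurable_sets[of _ borel borel A] A by (simp add: X_def)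
    also have "sets (borel :: ('g \<times> 'g) measure) = sets (N \<Otimes>\<^sub>M M)"
      using sets by (simp add: borel_prod[symmetric] cong: sets_pair_measure_cong)
    finally have X: "X \<in> sets (N \<Otimes>\<^sub>M M)" .
    have "Pair x -` X = (+) x -` A" "(\<lambda>x. (x, y)) -` X = (\<lambda>x. x + y) -` A" for x y
      by (auto simp: X_def)
    then have "(\<integral>\<^sup>+x. emeasure M A \<partial>N) = (\<integral>\<^sup>+y. emeasure N A \<partial>M)"
      using NM.M2.emeasure_pair_measure_alt[OF X] NM.emeasure_pair_measure_alt2[OF X]
      by (simp add: left[OF A] right[OF A])
    then show ?thesis
      by (simp add: sp)
  qed
  have "emeasure M A = 0 \<longleftrightarrow> emeasure N A = 0" if "A \<in> sets borel" for A
    using key[OF that] ne by (metis mult_eq_0_iff)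
  then show ?thesis
    using sets by (auto simp: null_sets_def)
qed

lemma haar_measure_vimage:
  assumes "haar_measure M" "A \<in> sets borel"
  shows "emeasure M ((+) g -` A) = emeasure M A"
proof -
  have "(+) g -` A = (+) (- g) ` A"
  proof (intro set_eqI iffI)
    fix k assume "k \<in> (+) g -` A"
    then have "g + k \<in> A" "k = - g + (g + k)" by (simp_all add: add.assoc[symmetric])
    then show "k \<in> (+) (- g) ` A" by blast
  qed (auto simp: add.assoc[symmetric])
  then show ?thesis
    using assms by (simp add: haar_measure_def)
qed

lemma
  fixes M :: "'g::{polish_space, topological_group_add} measure"
  assumes M: "haar_measure M" and lc: "locally compact (UNIV :: 'g set)"
  shows sigma_finite_reflected: "sigma_finite_measure (reflected M)"
    and translation_recurrent_completion_reflected: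
      "translation_recurrent (completion (reflected M))"
proof -
  have op: "open (uminus -` U)" if "open U" for U :: "'g set"
    using that by (intro open_vimage continuous_intros)
  have e: "emeasure (reflected M) (uminus -` U) = emeasure M U" if "open U" for U
    using emeasure_reflected[OF M, of "uminus -` U"] op[OF that] by (simp add: vimage_def)
  obtain \<U> where \<U>: "countable \<U>" "\<And>U. U \<in> \<U> \<Longrightarrow> open U \<and> emeasure M U < \<infinity>" "\<Union>\<U> = UNIV"
    using haar_measure_countable_cover[OF assms] by blast
  show "sigma_finite_measure (reflected M)"
  proof
    have "\<Union>((\<lambda>U. uminus -` U) ` \<U>) = (UNIV :: 'g set)"
      using \<U>(3) by (simp add: vimage_Union[symmetric])
    moreover have "uminus -` U \<in> sets (reflected M)" if "U \<in> \<U>" for U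
      using \<U>(2)[OF that] op sets_reflected[OF M] by simp
    moreover have "emeasure (reflected M) (uminus -` U) \<noteq> \<infinity>" if "U \<in> \<U>" for U
      using \<U>(2)[OF that] e by (simp add: less_top)
    ultimately show "\<exists>A. countable A \<and> A \<subseteq> sets (reflected M) \<and> \<Union>A = space (reflected M) \<and>
        (\<forall>a\<in>A. emeasure (reflected M) a \<noteq> \<infinity>)"
      using \<U>(1) space_reflected[OF M]
      by (intro exI[of _ "(\<lambda>U. uminus -` U) ` \<U>"]) (simp add: image_subset_iff)
  qed
  obtain U where U: "open U" "0 < emeasure M U" "emeasure M U < \<infinity>"
    using haar_measure_open[OF assms] by blast
  show "translation_recurrent (completion (reflected M))"
    using U e[OF U(1)]
    by (intro translation_recurrent_completion[OF sets_reflected[OF M]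
          emeasure_reflected_translation[OF M] op[OF U(1)]]) simp_all
qed

text \<open>
  Comparing every Haar measure \<open>M'\<close> with the same right Haar measure shows that measurability with
  respect to the completion does not depend on the choice of \<open>M'\<close>.
\<close>

lemma sets_completion_reflected:
  fixes M M' :: "'g::{polish_space, topological_group_add} measure"
  assumes M: "haar_measure M" "haar_measure M'" and lc: "locally compact (UNIV :: 'g set)"
  shows "sets (completion M') = sets (completion (reflected M))"
proof -
  have "emeasure (reflected M) UNIV \<noteq> 0" "emeasure M' UNIV \<noteq> 0"
    using M emeasure_reflected[OF M(1), of UNIV] by (auto simp: haar_measure_def)
  then have "null_sets M' = null_sets (reflected M)"
    using M lc
    by (intro left_right_invariant_null_sets haar_measure_sigma_finite sigma_finite_reflected
        haar_measure_vimage emeasure_reflected_translation sets_reflected haar_measure_space)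
  then show ?thesis
    using sets_completion_mono[of M' "reflected M"] sets_completion_mono[of "reflected M" M']
      haar_measure_space(1)[OF M(2)] sets_reflected[OF M(1)] by auto
qed

section \<open>Sections of maps measurable on a product\<close>

lemma AE_section_in_sets_completion:
  assumes fin: "sigma_finite_measure \<nu>" "sigma_finite_measure \<mu>"
    and A: "A \<in> sets (completion (\<nu> \<Otimes>\<^sub>M \<mu>))"
  shows "AE x in \<mu>. (\<lambda>g. (g, x)) -` A \<in> sets (completion \<nu>)"
proof -
  interpret pair_sigma_finite \<nu> \<mu>
    using fin by (simp add: pair_sigma_finite_def)
  obtain S Z Z' where S: "A = S \<union> Z" "Z \<subseteq> Z'" "Z' \<in> null_sets (\<nu> \<Otimes>\<^sub>M \<mu>)" "S \<in> sets (\<nu> \<Otimes>\<^sub>M \<mu>)"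
    using A by (rule sets_completionE)
  have Z': "Z' \<in> sets (\<nu> \<Otimes>\<^sub>M \<mu>)" "emeasure (\<nu> \<Otimes>\<^sub>M \<mu>) Z' = 0"
    using S(3) by auto
  have "(\<integral>\<^sup>+x. emeasure \<nu> ((\<lambda>g. (g, x)) -` Z') \<partial>\<mu>) = 0"
    using emeasure_pair_measure_alt2[OF Z'(1)] Z'(2) by simp
  then have "AE x in \<mu>. emeasure \<nu> ((\<lambda>g. (g, x)) -` Z') = 0"
    using measurable_emeasure_Pair2[OF Z'(1)] by (simp add: nn_integral_0_iff_AE)
  then show ?thesis
  proof eventually_elim
    case (elim x)
    then have "(\<lambda>g. (g, x)) -` Z' \<in> null_sets \<nu>"
      using sets_Pair2[OF Z'(1)] by (simp add: null_sets_def)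
    then show ?case
      using sets_Pair2[OF S(4)] S(1,2)
      by (intro sets_completionI[of _ "(\<lambda>g. (g, x)) -` S" "(\<lambda>g. (g, x)) -` Z"
            "(\<lambda>g. (g, x)) -` Z'"]) auto
  qed
qed

text \<open>
  Almost every section is measurable, and full support turns a conull set into a dense one: the
  complement of its closure is an open null set.
\<close>

lemma dense_measurable_sections:
  fixes f :: "'a \<times> 'b::topological_space \<Rightarrow> 'c::second_countable_topology"
  assumes fin: "sigma_finite_measure \<nu>" "sigma_finite_measure \<mu>"
    and sp: "space \<nu> = UNIV" "sets \<mu> = sets borel" and full: "fully_supported \<mu>"
    and f: "f \<in> borel_measurable (completion (\<nu> \<Otimes>\<^sub>M \<mu>))"
  shows "closure {x. (\<lambda>g. f (g, x)) \<in> borel_measurable (completion \<nu>)} = UNIV"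
proof -
  have sp\<mu>: "space \<mu> = UNIV" using sets_eq_imp_space_eq[OF sp(2)] by simp
  obtain \<B> :: "'c set set" where \<B>: "countable \<B>" "topological_basis \<B>"
    using ex_countable_basis by blast
  have "f -` U \<in> sets (completion (\<nu> \<Otimes>\<^sub>M \<mu>))" if "U \<in> \<B>" for U
    using measurable_sets[OF f borel_open[OF topological_basis_open[OF \<B>(2) that]]] sp sp\<mu>
    by (simp add: space_pair_measure)
  then have "AE x in \<mu>. \<forall>U\<in>\<B>. (\<lambda>g. (g, x)) -` (f -` U) \<in> sets (completion \<nu>)"
    using \<B>(1) fin by (simp add: AE_ball_countable AE_section_in_sets_completion)
  then have ae: "AE x in \<mu>. (\<lambda>g. f (g, x)) \<in> borel_measurable (completion \<nu>)"
  proof eventually_elim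
    case (elim x)
    show ?case
      by (rule borel_measurable_basisI[OF \<B>]) (use elim sp in \<open>simp add: vimage_def\<close>)
  qed
  let ?D = "{x. (\<lambda>g. f (g, x)) \<in> borel_measurable (completion \<nu>)}"
  have "AE x in \<mu>. x \<notin> - closure ?D"
    using ae by eventually_elim (use closure_subset[of ?D] in blast)
  then have "emeasure \<mu> (- closure ?D) = 0"
    by (subst (asm) AE_iff_measurable[where N="- closure ?D"]) (auto simp: sp sp\<mu>)
  then have "- closure ?D = {}"
    using full unfolding fully_supported_def by (metis closed_closure less_irrefl open_Compl)
  then show ?thesis by auto
qed

section \<open>The four criteria for joint continuity\<close>

theorem theorem1p1:
  fixes act :: "'g::{polish_space, topological_group_add} \<Rightarrow> 'x::polish_space \<Rightarrow> 'x"
    and \<psi> :: "'g \<times> 'x \<Rightarrow> 'h::{polish_space, topological_group_add}"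
  assumes "polish_group_action act"
    and "cocycle act \<psi>"
    and "\<And>g. continuous_on UNIV (\<lambda>x. \<psi> (g, x))"
  shows "(baire_measurable \<psi> \<longrightarrow> continuous_on UNIV \<psi>) \<and>
    ((\<exists>D. closure D = UNIV \<and> (\<forall>x\<in>D. baire_measurable (\<lambda>g. \<psi> (g, x))))
        \<longrightarrow> continuous_on UNIV \<psi>) \<and>
    (locally compact (UNIV :: 'g set) \<and>
      (\<exists>D. closure D = UNIV \<and> (\<forall>x\<in>D. haar_measurable (\<lambda>g. \<psi> (g, x))))
        \<longrightarrow> continuous_on UNIV \<psi>) \<and>
    (\<forall>\<nu> :: 'g measure. locally compact (UNIV :: 'g set) \<and> haar_measure \<nu> \<and>
      (\<exists>\<mu> :: 'x measure. sets \<mu> = sets borel \<and> sigma_finite_measure \<mu> \<and> fully_supported \<mu> \<and>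
        \<psi> \<in> borel_measurable (completion (\<nu> \<Otimes>\<^sub>M \<mu>)))
        \<longrightarrow> continuous_on UNIV \<psi>)"
proof -
  note criterion = cocycle_continuous_if_recurrent[OF assms]
  have baire: "continuous_on UNIV \<psi>"
    if "closure D = UNIV" "\<forall>x\<in>D. baire_measurable (\<lambda>g. \<psi> (g, x))" for D
    using that
    by (intro criterion[OF _ translation_recurrent_baire_algebra that(1)])
       (auto simp: borel_measurable_baire_algebra_iff)
  have haar: "continuous_on UNIV \<psi>"
    if lc: "locally compact (UNIV :: 'g set)" and D: "closure D = UNIV"
      and mD: "\<forall>x\<in>D. haar_measurable (\<lambda>g. \<psi> (g, x))" for D
  proof -
    have "D \<noteq> {}" using D by auto
    then obtain M :: "'g measure" where M: "haar_measure M"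
      using mD by (auto simp: haar_measurable_def)
    show ?thesis
    proof (rule criterion[OF _ translation_recurrent_completion_reflected[OF M lc] D])
      show "space (completion (reflected M)) = UNIV"
        using space_reflected[OF M] by simp
      fix x assume "x \<in> D"
      then obtain M' :: "'g measure"
        where M': "haar_measure M'" "(\<lambda>g. \<psi> (g, x)) \<in> borel_measurable (completion M')"
        using mD by (auto simp: haar_measurable_def)
      show "(\<lambda>g. \<psi> (g, x)) \<in> borel_measurable (completion (reflected M))"
        using M'(2) measurable_cong_sets[OF sets_completion_reflected[OF M M'(1) lc] refl, of "borel :: 'h measure"]
        by simp
    qed
  qed
  have product: "continuous_on UNIV \<psi>"
    if lc: "locally compact (UNIV :: 'g set)" and \<nu>: "haar_measure \<nu>"
      and \<mu>: "sets \<mu> = sets borel" "sigma_finite_measure \<mu>" "fully_supported \<mu>"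
      and m: "\<psi> \<in> borel_measurable (completion (\<nu> \<Otimes>\<^sub>M \<mu>))" for \<nu> :: "'g measure" and \<mu> :: "'x measure"
  proof (rule haar[OF lc])
    show "closure {x. (\<lambda>g. \<psi> (g, x)) \<in> borel_measurable (completion \<nu>)} = UNIV"
      by (rule dense_measurable_sections[OF haar_measure_sigma_finite[OF \<nu> lc] \<mu>(2)
            haar_measure_space(2)[OF \<nu>] \<mu>(1,3) m])
    show "\<forall>x\<in>{x. (\<lambda>g. \<psi> (g, x)) \<in> borel_measurable (completion \<nu>)}. haar_measurable (\<lambda>g. \<psi> (g, x))"
      using \<nu> by (auto simp: haar_measurable_def)
  qed
  show ?thesis
    using baire[OF dense_baire_measurable_sections] baire haar product by blast
qed

end
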